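(* Let $G=(V,E)$ be a DAG with topological order $v_1,\ldots,v_{|V|}$, let $i\in\{1,\ldots,|V|\}$, and for $t\in\{0,\ldots,|V|\}$ let $S_t$ be the support of $G_t=G[\{v_1,\ldots,v_t\}]$. Then reachability among the vertices of $S_{i-1}\cup\{v_i\}$ is determined by knowing, for every $j\in\{1,\ldots,i\}$, which vertices of $S_{j-1}$ reach $v_j$: namely, for all $v_s,v_t\in S_{i-1}\cup\{v_i\}$, $v_s$ reaches $v_t$ if and only if either $s=t$, or $s<t$, $v_s\in S_{t-1}$ and $v_s$ reaches $v_t$; and whenever $s<t$ one has $v_s\in S_{t-1}$.
   Context: A topological order is an ordering of the vertices such that every edge goes from an earlier to a later vertex; $G_0$ is the empty graph. In a directed graph $H$, $u$ reaches $v$ if there is a path (sequence of distinct vertices, consecutive ones joined by edges of $H$, at least one vertex) from $u$ to $v$ in $H$. An antichain of $H$ is a set of vertices no one of which reaches a different one in $H$. A set $A$ reaches $v$ if some $u\in A$ reaches $v$. For antichains $A,B$ of $H$ of the same size, $B$ dominates $A$ (in $H$) if for every $b\in B$, $A$ reaches $b$ in $H$; antichains of different sizes are not related. An $H$-frontier antichain is an antichain of $H$ not dominated in $H$ by any other antichain of $H$. The support $S_t$ of $G_t$ is the union of all $G_t$-frontier antichains. *)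

theory Defs
  imports "Graph_Theory.Graph_Theory"
begin

locale dag = digraph +
  assumes no_cycle: "\<nexists>p. cycle p"

text \<open>A vertex ordering is given by its (1-based) enumeration; only the values at
  indices between 1 and the number of vertices matter.\<close>

definition topological_order :: "('a, 'b) pre_digraph \<Rightarrow> (nat \<Rightarrow> 'a) \<Rightarrow> bool" where
  "topological_order G v \<longleftrightarrow>
     bij_betw v {1..card (verts G)} (verts G) \<and>
     (\<forall>j\<in>{1..card (verts G)}. \<forall>k\<in>{1..card (verts G)}. v j \<rightarrow>\<^bsub>G\<^esub> v k \<longrightarrow> j < k)"

definition reaches :: "('a, 'b) pre_digraph \<Rightarrow> 'a \<Rightarrow> 'a \<Rightarrow> bool" where
  "reaches H u v \<longleftrightarrow> (\<exists>p. vpath p H \<and> hd p = u \<and> last p = v)"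

definition set_reaches :: "('a, 'b) pre_digraph \<Rightarrow> 'a set \<Rightarrow> 'a \<Rightarrow> bool" where
  "set_reaches H A v \<longleftrightarrow> (\<exists>u\<in>A. reaches H u v)"

definition antichain :: "('a, 'b) pre_digraph \<Rightarrow> 'a set \<Rightarrow> bool" where
  "antichain H A \<longleftrightarrow> A \<subseteq> verts H \<and> (\<forall>u\<in>A. \<forall>v\<in>A. u \<noteq> v \<longrightarrow> \<not> reaches H u v)"

definition antichain_dominates :: "('a, 'b) pre_digraph \<Rightarrow> 'a set \<Rightarrow> 'a set \<Rightarrow> bool" where
  "antichain_dominates H B A \<longleftrightarrow>
     antichain H A \<and> antichain H B \<and> card A = card B \<and> (\<forall>b\<in>B. set_reaches H A b)"

definition frontier_antichain :: "('a, 'b) pre_digraph \<Rightarrow> 'a set \<Rightarrow> bool" where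
  "frontier_antichain H A \<longleftrightarrow>
     antichain H A \<and> (\<nexists>B. antichain H B \<and> B \<noteq> A \<and> antichain_dominates H B A)"

definition support :: "('a, 'b) pre_digraph \<Rightarrow> 'a set" where
  "support H = \<Union> {A. frontier_antichain H A}"

definition prefix_graph :: "('a, 'b) pre_digraph \<Rightarrow> (nat \<Rightarrow> 'a) \<Rightarrow> nat \<Rightarrow> ('a, 'b) pre_digraph" where
  "prefix_graph G v t = G \<restriction> (v ` {1..t})"

definition prefix_support :: "('a, 'b) pre_digraph \<Rightarrow> (nat \<Rightarrow> 'a) \<Rightarrow> nat \<Rightarrow> 'a set" where
  "prefix_support G v t = support (prefix_graph G v t)"

end

theory Submission
  imports Defs
begin

text \<open>Let \<open>U\<close> be closed under predecessors in \<open>H\<close> and let \<open>A\<close> be an \<open>H\<close>-frontier antichain. Then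
  \<open>A \<inter> U\<close> is a frontier antichain of \<open>H \<restriction> U\<close>: if an antichain \<open>B \<noteq> A \<inter> U\<close> of \<open>H \<restriction> U\<close> dominated
  it, then \<open>B \<union> (A - U)\<close> would dominate \<open>A\<close>. Indeed, no vertex outside \<open>U\<close> reaches one in \<open>B\<close>,
  and a vertex of \<open>B\<close> reaching some \<open>c \<in> A - U\<close> would, through domination, yield a vertex of
  \<open>A \<inter> U\<close> reaching \<open>c\<close>. Hence a vertex of \<open>S\<^sub>n\<close> lies in \<open>S\<^sub>m\<close> for every \<open>m \<le> n\<close> for
  which it belongs to \<open>G\<^sub>m\<close>.\<close>

text \<open>Paths and walks connect the same pairs of vertices, so transitivity and induction along
  edges become available for \<open>reaches\<close>.\<close>

lemma (in wf_digraph) reaches_iff_reachable: "reaches G u w \<longleftrightarrow> u \<rightarrow>\<^sup>* w"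
  by (simp add: reaches_def reachable_vpath_conv)

text \<open>Here \<open>G\<close> is the larger graph of a nested pair. It is later instantiated
  with the prefix graph on \<open>n\<close> vertices, and \<open>U\<close> with the first
  \<open>m\<close> of these.\<close>

locale predecessor_closed = fin_digraph +
  fixes U :: "'a set"
  assumes U_verts: "U \<subseteq> verts G"
    and predecessor_closed: "u \<rightarrow> w \<Longrightarrow> w \<in> U \<Longrightarrow> u \<in> U"
begin

text \<open>Traced backwards from \<open>w\<close>, a walk can never leave \<open>U\<close>, so all
  of its edges survive in the induced subgraph.\<close>

lemma reachable_into_closed:
  assumes "u \<rightarrow>\<^sup>* w" "w \<in> U"
  shows "u \<in> U \<and> u \<rightarrow>\<^sup>*\<^bsub>G \<restriction> U\<^esub> w"
  using assms
proof (induction rule: converse_reachable_induct)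
  case base
  then show ?case
    by (simp add: wf_digraph.reachable_refl wellformed_induce_subgraph)
next
  case (step x y)
  then have "x \<in> U" "y \<in> U" "y \<rightarrow>\<^sup>*\<^bsub>G \<restriction> U\<^esub> w"
    using predecessor_closed by auto
  moreover have "x \<rightarrow>\<^bsub>G \<restriction> U\<^esub> y"
    using step.hyps(1) \<open>x \<in> U\<close> \<open>y \<in> U\<close>
    by (auto simp: arcs_ends_def arc_to_ends_def image_iff)
  ultimately show ?case
    using wf_digraph.adj_reachable_trans[OF wellformed_induce_subgraph] by blast
qed

text \<open>Only the target has to lie in \<open>U\<close>: a source outside \<open>U\<close>
  reaches nothing in \<open>U\<close>, in either graph.\<close>

lemma reaches_induce_iff:
  assumes "w \<in> U"
  shows "reaches (G \<restriction> U) u w \<longleftrightarrow> reaches G u w"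
  using assms reachable_into_closed reachable_induce_subgraphD[OF _ U_verts]
  by (auto simp: reaches_iff_reachable wf_digraph.reaches_iff_reachable wellformed_induce_subgraph)

lemma antichain_induce_iff: "antichain (G \<restriction> U) A \<longleftrightarrow> A \<subseteq> U \<and> antichain G A"
  using U_verts reaches_induce_iff unfolding antichain_def by (auto; blast)

lemma frontier_antichain_induce:
  assumes A: "frontier_antichain G A"
  shows "frontier_antichain (G \<restriction> U) (A \<inter> U)"
proof -
  have antiA: "antichain G A"
    using A by (simp add: frontier_antichain_def)
  then have A_verts: "A \<subseteq> verts G"
    by (simp add: antichain_def)
  have False if B: "antichain (G \<restriction> U) B" "B \<noteq> A \<inter> U"
    and dom: "antichain_dominates (G \<restriction> U) B (A \<inter> U)" for B
  proof -
    have BU: "B \<subseteq> U" and antiB: "antichain G B"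
      using B(1) by (simp_all add: antichain_induce_iff)
    have reachB: "\<exists>a\<in>A \<inter> U. reaches G a b" if "b \<in> B" for b
      using dom that BU reaches_induce_iff[of b]
      unfolding antichain_dominates_def set_reaches_def by blast
    have "\<not> reaches G c b" if "b \<in> B" "c \<in> A - U" for b c
      using that BU reachable_into_closed by (auto simp: reaches_iff_reachable)
    moreover have "\<not> reaches G b c" if bc: "b \<in> B" "c \<in> A - U" for b c
    proof
      assume "reaches G b c"
      moreover obtain a where "a \<in> A \<inter> U" "reaches G a b"
        using reachB bc(1) by blast
      ultimately have "reaches G a c"
        unfolding reaches_iff_reachable by (blast intro: reachable_trans)
      then show False
        using antiA \<open>a \<in> A \<inter> U\<close> bc(2) by (auto simp: antichain_def)
    qed
    ultimately have anti: "antichain G (B \<union> (A - U))"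
      using antiA antiB by (auto simp: antichain_def)
    have "card (B \<union> (A - U)) = card B + card (A - U)"
      using BU U_verts A_verts by (intro card_Un_disjoint) (auto intro: finite_subset[OF _ finite_verts])
    also have "\<dots> = card (A \<inter> U) + card (A - U)"
      using dom by (simp add: antichain_dominates_def)
    also have "\<dots> = card A"
      using card_Int_Diff[OF finite_subset[OF A_verts finite_verts], of U] by simp
    finally have card: "card A = card (B \<union> (A - U))" by simp
    have "set_reaches G A b" if "b \<in> B \<union> (A - U)" for b
    proof (cases "b \<in> A")
      case True
      then show ?thesis
        using A_verts by (auto simp: set_reaches_def reaches_iff_reachable)
    next
      case False
      then show ?thesis
        using that reachB by (auto simp: set_reaches_def)
    qed
    then have "antichain_dominates G (B \<union> (A - U)) A"
      using antiA anti card by (simp add: antichain_dominates_def)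
    \<comment> \<open>Intersecting the left side with \<open>U\<close> gives back \<open>B\<close>,
      which differs from \<open>A \<inter> U\<close>.\<close>
    moreover have "B \<union> (A - U) \<noteq> A"
      using B(2) BU by auto
    ultimately show False
      using A anti by (auto simp: frontier_antichain_def)
  qed
  moreover have "antichain (G \<restriction> U) (A \<inter> U)"
    using antiA unfolding antichain_induce_iff by (auto simp: antichain_def)
  ultimately show ?thesis
    by (auto simp: frontier_antichain_def)
qed

lemma support_Int_subset: "support G \<inter> U \<subseteq> support (G \<restriction> U)"
  using frontier_antichain_induce by (fastforce simp: support_def)

end

lemma support_subset_verts: "support H \<subseteq> verts H"
  by (auto simp: support_def frontier_antichain_def antichain_def)

lemma prefix_support_subset: "prefix_support G v t \<subseteq> v ` {1..t}"
  using support_subset_verts[of "prefix_graph G v t"]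
  by (simp add: prefix_support_def prefix_graph_def)

lemma prefix_graph_induce:
  assumes "m \<le> n"
  shows "prefix_graph G v n \<restriction> (v ` {1..m}) = prefix_graph G v m"
proof -
  have "v ` {1..m} \<subseteq> v ` {1..n}"
    using assms by auto
  then show ?thesis
    by (auto simp: prefix_graph_def induce_subgraph_def)
qed

lemma topological_order_eq_iff:
  assumes "topological_order G v" "j \<in> {1..card (verts G)}" "k \<in> {1..card (verts G)}"
  shows "v j = v k \<longleftrightarrow> j = k"
  using assms inj_on_eq_iff[of v "{1..card (verts G)}"]
  by (auto simp: topological_order_def bij_betw_def)

text \<open>Every edge of a walk strictly increases the index; equality is left for the trivial
  walk.\<close>

lemma (in wf_digraph) topological_order_reachable_le:
  assumes v: "topological_order G v"
    and "v j \<rightarrow>\<^sup>* v k" "j \<in> {1..card (verts G)}" "k \<in> {1..card (verts G)}"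
  shows "j \<le> k"
  using assms(2,3)
proof (induction "v j" arbitrary: j rule: converse_reachable_induct)
  case base
  then show ?case
    using topological_order_eq_iff[OF v _ assms(4)] by auto
next
  case (step y)
  \<comment> \<open>The induction hypothesis speaks of indices, so the second vertex of the walk
    needs one; surjectivity of \<open>v\<close> onto the vertices supplies it.\<close>
  have "y \<in> verts G"
    using step.hyps(1) by (rule adj_in_verts)
  then obtain l where l: "y = v l" "l \<in> {1..card (verts G)}"
    using v unfolding topological_order_def bij_betw_def by blast
  then have "j < l"
    using v step.hyps(1) step.prems by (auto simp: topological_order_def)
  moreover have "l \<le> k"
    using step.hyps(3) l by blast
  ultimately show ?case by simp
qed

lemma prefix_support_mono:
  assumes G: "fin_digraph G" and v: "topological_order G v"
    and mn: "m \<le> n" "n \<le> card (verts G)"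
  shows "prefix_support G v n \<inter> v ` {1..m} \<subseteq> prefix_support G v m"
proof -
  interpret fin_digraph G by fact
  have "v ` {1..n} \<subseteq> verts G"
    using v mn by (force simp: topological_order_def bij_betw_def)
  \<comment> \<open>Edges go from smaller to larger indices, so an initial segment of the order
    contains all predecessors of its vertices.\<close>
  interpret P: predecessor_closed "prefix_graph G v n" "v ` {1..m}"
  proof (intro predecessor_closed.intro predecessor_closed_axioms.intro)
    show "fin_digraph (prefix_graph G v n)"
      unfolding prefix_graph_def using \<open>v ` {1..n} \<subseteq> verts G\<close>
      by (intro fin_digraph.intro fin_digraph_axioms.intro) auto
    show "v ` {1..m} \<subseteq> verts (prefix_graph G v n)"
      using mn by (auto simp: prefix_graph_def)
    show "u \<in> v ` {1..m}"
      if uw: "u \<rightarrow>\<^bsub>prefix_graph G v n\<^esub> w" and w: "w \<in> v ` {1..m}" for u w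
    proof -
      have "u \<in> v ` {1..n}" "u \<rightarrow>\<^bsub>G\<^esub> w"
        using uw by (auto simp: prefix_graph_def arcs_ends_def arc_to_ends_def)
      then obtain j k where "u = v j" "j \<in> {1..n}" "w = v k" "k \<in> {1..m}" "v j \<rightarrow>\<^bsub>G\<^esub> v k"
        using w by auto
      then have "j < k"
        using v mn by (auto simp: topological_order_def)
      then show ?thesis
        using \<open>u = v j\<close> \<open>j \<in> {1..n}\<close> \<open>k \<in> {1..m}\<close> by auto
    qed
  qed
  show ?thesis
    using P.support_Int_subset unfolding prefix_graph_induce[OF mn(1)] prefix_support_def .
qed

theorem theorem2:
  fixes G :: "('a, 'b) pre_digraph" and v :: "nat \<Rightarrow> 'a" and i :: nat
  assumes "dag G"
    and "topological_order G v"
    and "i \<in> {1..card (verts G)}"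
  shows "\<forall>s\<in>{1..card (verts G)}. \<forall>t\<in>{1..card (verts G)}.
    v s \<in> prefix_support G v (i - 1) \<union> {v i} \<and> v t \<in> prefix_support G v (i - 1) \<union> {v i} \<longrightarrow>
      t \<in> {1..i} \<and>
      (reaches G (v s) (v t) \<longleftrightarrow>
         s = t \<or> (s < t \<and> v s \<in> prefix_support G v (t - 1) \<and> reaches G (v s) (v t))) \<and>
      (s < t \<longrightarrow> v s \<in> prefix_support G v (t - 1))"
proof (intro ballI impI)
  interpret dag G by fact
  note v = assms(2)
  fix s t
  assume s: "s \<in> {1..card (verts G)}" and t: "t \<in> {1..card (verts G)}"
    and st: "v s \<in> prefix_support G v (i - 1) \<union> {v i} \<and> v t \<in> prefix_support G v (i - 1) \<union> {v i}"
  \<comment> \<open>Vertices of the support have indices at most \<open>i - 1\<close>, and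
    \<open>v\<close> is injective. So an index below \<open>i\<close> rules out \<open>v i\<close>
    and leaves membership in the support.\<close>
  have index: "k \<le> i \<and> (k < i \<longrightarrow> v k \<in> prefix_support G v (i - 1))"
    if k: "k \<in> {1..card (verts G)}" and "v k \<in> prefix_support G v (i - 1) \<union> {v i}" for k
  proof (cases "v k = v i")
    case True
    then show ?thesis
      using topological_order_eq_iff[OF v k assms(3)] by simp
  next
    case False
    then have S: "v k \<in> prefix_support G v (i - 1)"
      using that by simp
    then obtain l where "l \<in> {1..i - 1}" "v k = v l"
      using prefix_support_subset by fastforce
    then show ?thesis
      using S topological_order_eq_iff[OF v k, of l] assms(3) by auto
  qed
  have "t \<le> i"
    using index t st by blast
  \<comment> \<open>From \<open>s < t \<le> i\<close> the vertex \<open>v s\<close> is not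
    \<open>v i\<close>, so it lies in the support at \<open>i - 1\<close>. It is already among the
    first \<open>t - 1\<close> vertices, so monotonicity with \<open>m = t - 1\<close> and
    \<open>n = i - 1\<close> applies.\<close>
  have support: "v s \<in> prefix_support G v (t - 1)" if "s < t"
  proof -
    have "v s \<in> prefix_support G v (i - 1)"
      using index[OF s] st \<open>t \<le> i\<close> that by auto
    moreover have "v s \<in> v ` {1..t - 1}"
      using s that by auto
    moreover have "t - 1 \<le> i - 1" "i - 1 \<le> card (verts G)"
      using \<open>t \<le> i\<close> assms(3) by auto
    ultimately show ?thesis
      using prefix_support_mono[OF fin_digraph_axioms v] by blast
  qed
  \<comment> \<open>With \<open>support\<close> at hand, the equivalence only needs reflexivity for
    \<open>s = t\<close> and the exclusion of \<open>t < s\<close>.\<close>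
  have "reaches G (v s) (v s)"
    using s v by (auto simp: reaches_iff_reachable topological_order_def bij_betw_def)
  moreover have "s \<le> t" if "reaches G (v s) (v t)"
    using topological_order_reachable_le[OF v _ s t] that by (simp add: reaches_iff_reachable)
  ultimately show "t \<in> {1..i} \<and>
      (reaches G (v s) (v t) \<longleftrightarrow>
         s = t \<or> (s < t \<and> v s \<in> prefix_support G v (t - 1) \<and> reaches G (v s) (v t))) \<and>
      (s < t \<longrightarrow> v s \<in> prefix_support G v (t - 1))"
    using support \<open>t \<le> i\<close> t by (auto simp: le_less)
qed

end
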